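(* One has $$D_1\cap D_2\cap D_3=\{(\alpha,\beta)\in\mathbb{R}^2\mid \alpha+\beta\ge 1,\ \alpha\ge 1,\ |\beta|\le 1\}$$ and $$D_1'\cap D_2'\cap D_3'=\{(a,b)\in\mathbb{R}^2\mid a\ge 1,\ a-1\ge b\ge -a-1\}.$$
   Context: Define the subsets of the $(\alpha,\beta)$-plane $D_1=\{(\alpha,\beta)\in\mathbb{R}^2\mid \alpha+\beta\ge1,\ \alpha\ge1,\ |\alpha|\ge|\beta|\}$, $D_2=\{(\alpha,\beta)\in\mathbb{R}^2\mid |\alpha+\beta|\ge|\beta|,\ |\alpha|\ge|\beta|\}$, $D_3=\{(\alpha,\beta)\in\mathbb{R}^2\mid |\beta|\le1,\ |\alpha|\ge|\beta|\}$. For $(a,b)\in\mathbb{R}^2$, let $\alpha,\beta$ denote the two (possibly complex, possibly equal) roots of $x^2-ax+b$, labelled so that $|\alpha|\ge|\beta|$ (either labelling if the moduli are equal), and define the subsets of the $(a,b)$-plane $D_1'=\{(a,b)\in\mathbb{R}^2\mid a\ge1,\ \alpha\ge1,\ |\alpha|\ge|\beta|\}$, $D_2'=\{(a,b)\in\mathbb{R}^2\mid |a|\ge|\beta|,\ |\alpha|\ge|\beta|\}$, $D_3'=\{(a,b)\in\mathbb{R}^2\mid |\beta|\le1,\ |\alpha|\ge|\beta|\}$. Here the condition $\alpha\ge1$ means that $\alpha$ is real and at least $1$. *)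

theory Defs
  imports Complex_Main "HOL-Computational_Algebra.Polynomial"
begin

definition D1 :: "(real \<times> real) set" where
  "D1 = {(\<alpha>, \<beta>). \<alpha> + \<beta> \<ge> 1 \<and> \<alpha> \<ge> 1 \<and> \<bar>\<alpha>\<bar> \<ge> \<bar>\<beta>\<bar>}"

definition D2 :: "(real \<times> real) set" where
  "D2 = {(\<alpha>, \<beta>). \<bar>\<alpha> + \<beta>\<bar> \<ge> \<bar>\<beta>\<bar> \<and> \<bar>\<alpha>\<bar> \<ge> \<bar>\<beta>\<bar>}"

definition D3 :: "(real \<times> real) set" where
  "D3 = {(\<alpha>, \<beta>). \<bar>\<beta>\<bar> \<le> 1 \<and> \<bar>\<alpha>\<bar> \<ge> \<bar>\<beta>\<bar>}"

text \<open>
  The polynomial identity says that \<open>\<alpha>\<close> and \<open>\<beta>\<close> are the two roots of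
  \<open>x^2 - a x + b\<close>, counted with multiplicity.
\<close>

definition labelled_roots :: "real \<Rightarrow> real \<Rightarrow> complex \<Rightarrow> complex \<Rightarrow> bool" where
  "labelled_roots a b \<alpha> \<beta> \<longleftrightarrow>
     [:complex_of_real b, - complex_of_real a, 1:] = [:- \<alpha>, 1:] * [:- \<beta>, 1:] \<and> cmod \<alpha> \<ge> cmod \<beta>"

text \<open>
  A labelling is a choice of \<open>\<alpha>\<close> and \<open>\<beta>\<close> for every \<open>(a, b)\<close>. It is not unique, since either
  order of the roots is allowed when their moduli agree; the sets below therefore take the
  labelling as a parameter.
\<close>

definition root_labelling :: "(real \<Rightarrow> real \<Rightarrow> complex) \<Rightarrow> (real \<Rightarrow> real \<Rightarrow> complex) \<Rightarrow> bool" where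
  "root_labelling \<alpha> \<beta> \<longleftrightarrow> (\<forall>a b. labelled_roots a b (\<alpha> a b) (\<beta> a b))"

definition D1' :: "(real \<Rightarrow> real \<Rightarrow> complex) \<Rightarrow> (real \<Rightarrow> real \<Rightarrow> complex) \<Rightarrow> (real \<times> real) set" where
  "D1' \<alpha> \<beta> = {(a, b). a \<ge> 1 \<and> (\<alpha> a b \<in> \<real> \<and> Re (\<alpha> a b) \<ge> 1) \<and> cmod (\<alpha> a b) \<ge> cmod (\<beta> a b)}"

definition D2' :: "(real \<Rightarrow> real \<Rightarrow> complex) \<Rightarrow> (real \<Rightarrow> real \<Rightarrow> complex) \<Rightarrow> (real \<times> real) set" where
  "D2' \<alpha> \<beta> = {(a, b). \<bar>a\<bar> \<ge> cmod (\<beta> a b) \<and> cmod (\<alpha> a b) \<ge> cmod (\<beta> a b)}"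

definition D3' :: "(real \<Rightarrow> real \<Rightarrow> complex) \<Rightarrow> (real \<Rightarrow> real \<Rightarrow> complex) \<Rightarrow> (real \<times> real) set" where
  "D3' \<alpha> \<beta> = {(a, b). cmod (\<beta> a b) \<le> 1 \<and> cmod (\<alpha> a b) \<ge> cmod (\<beta> a b)}"

lemma root_labelling_exists: "\<exists>\<alpha> \<beta>. root_labelling \<alpha> \<beta>"
proof -
  have "\<exists>\<alpha> \<beta>. labelled_roots a b \<alpha> \<beta>" for a b
  proof -
    define d where "d = csqrt (complex_of_real (a\<^sup>2 - 4 * b))"
    define r where "r = (complex_of_real a + d) / 2"
    define s where "s = (complex_of_real a - d) / 2"
    have d: "d * d = of_real a * of_real a - 4 * of_real b"
      unfolding d_def by (simp flip: power2_eq_square)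
    have sm: "r + s = of_real a"
      by (simp add: r_def s_def field_simps)
    have pr: "r * s = of_real b"
      using d by (simp add: r_def s_def field_simps)
    have "labelled_roots a b r s" if "cmod s \<le> cmod r"
      using that by (simp add: labelled_roots_def mult.commute flip: sm pr)
    moreover have "labelled_roots a b s r" if "cmod r \<le> cmod s"
      using that by (simp add: labelled_roots_def mult.commute flip: sm pr)
    ultimately show ?thesis
      by (meson linear)
  qed
  then show ?thesis
    unfolding root_labelling_def by metis
qed

end

theory Submission
  imports Defs
begin

text \<open>
  The polynomial \<open>p = x\<^sup>2 - a x + b = (x - \<alpha>) (x - \<beta>)\<close> ties the two descriptions together: when the
  roots are real, \<open>a - 1 - b = - p 1 = (\<alpha> - 1) (1 - \<beta>)\<close> and
  \<open>b + a + 1 = p (- 1) = (\<alpha> + 1) (1 + \<beta>)\<close>. So the linear inequalities in \<open>a\<close> and \<open>b\<close> are sign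
  conditions on these products, and for \<open>\<alpha> + \<beta> \<ge> 1\<close> and \<open>\<bar>\<alpha>\<bar> \<ge> \<bar>\<beta>\<bar>\<close> they single out exactly the
  pairs with \<open>\<alpha> \<ge> 1\<close> and \<open>\<bar>\<beta>\<bar> \<le> 1\<close> (\<open>region_iff_products_nonneg\<close>). This requires the roots to be
  real, which \<open>b \<le> a - 1\<close> enforces because the discriminant is then at least \<open>(a - 2)\<^sup>2\<close>
  (\<open>roots_real\<close>). Finally, \<open>\<bar>\<alpha> + \<beta>\<bar> \<ge> \<bar>\<beta>\<bar>\<close> holds on these regions
  because \<open>\<alpha> + \<beta> \<ge> 1 \<ge> \<bar>\<beta>\<bar>\<close> there.
\<close>

lemma labelled_roots_vieta:
  assumes "labelled_roots a b \<alpha> \<beta>"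
  shows "\<alpha> + \<beta> = of_real a" "\<alpha> * \<beta> = of_real b"
  using assms by (auto simp: labelled_roots_def algebra_simps minus_equation_iff)

text \<open>
  Non-real roots would be conjugate with real part \<open>a / 2\<close>, so their product \<open>b\<close> would exceed
  \<open>a\<^sup>2 / 4 \<ge> a - 1\<close>.
\<close>

lemma roots_real:
  fixes \<alpha> \<beta> :: complex
  assumes sum: "\<alpha> + \<beta> = of_real a" and prod: "\<alpha> * \<beta> = of_real b" and "b \<le> a - 1"
  shows "\<alpha> \<in> \<real>"
proof (rule ccontr)
  assume "\<alpha> \<notin> \<real>"
  then have im: "Im \<alpha> \<noteq> 0"
    by (simp add: complex_is_Real_iff)
  have Im_\<beta>: "Im \<beta> = - Im \<alpha>" and Re_sum: "Re \<alpha> + Re \<beta> = a"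
    using arg_cong[OF sum, of Im] arg_cong[OF sum, of Re] by auto
  have "Im \<alpha> * (Re \<beta> - Re \<alpha>) = 0"
    using arg_cong[OF prod, of Im] by (simp add: Im_\<beta> algebra_simps)
  then have Re_eq: "Re \<beta> = Re \<alpha>"
    using im by simp
  have "(Re \<alpha>)\<^sup>2 + (Im \<alpha>)\<^sup>2 = b"
    using arg_cong[OF prod, of Re] by (simp add: Im_\<beta> Re_eq power2_eq_square)
  \<comment> \<open>Completing the square in \<open>b \<le> a - 1 = 2 Re \<alpha> - 1\<close>.\<close>
  then have "(Re \<alpha> - 1)\<^sup>2 + (Im \<alpha>)\<^sup>2 \<le> 0"
    using \<open>b \<le> a - 1\<close> Re_sum Re_eq by (simp add: power2_eq_square algebra_simps)
  then show False
    using im by (simp add: sum_power2_le_zero_iff)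
qed

text \<open>
  A positive sum turns \<open>\<bar>x\<bar> \<ge> \<bar>y\<bar>\<close> into \<open>x \<ge> y\<close> with \<open>x > 0\<close>. Then \<open>(x + 1) (1 + y) \<ge> 0\<close> amounts
  to \<open>y \<ge> - 1\<close>, and \<open>(x - 1) (1 - y) \<ge> 0\<close> says that \<open>1\<close> lies between \<open>y\<close> and \<open>x\<close>.
\<close>

lemma region_iff_products_nonneg:
  fixes x y :: real
  assumes "x + y \<ge> 1" and "\<bar>x\<bar> \<ge> \<bar>y\<bar>"
  shows "x \<ge> 1 \<and> \<bar>y\<bar> \<le> 1 \<longleftrightarrow> (x - 1) * (1 - y) \<ge> 0 \<and> (x + 1) * (1 + y) \<ge> 0"
proof -
  have "x \<ge> y" "x > 0"
    using assms by linarith+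
  then show ?thesis
    by (auto simp: zero_le_mult_iff abs_le_iff)
qed

lemma labelled_roots_region_iff:
  assumes roots: "labelled_roots a b \<alpha> \<beta>" and "a \<ge> 1"
  shows "\<alpha> \<in> \<real> \<and> Re \<alpha> \<ge> 1 \<and> cmod \<beta> \<le> 1 \<longleftrightarrow> b \<le> a - 1 \<and> b \<ge> - a - 1"
proof (cases "\<alpha> \<in> \<real>")
  case True
  note vieta = labelled_roots_vieta[OF roots]
  from True obtain x where x: "\<alpha> = of_real x"
    by (auto elim: Reals_cases)
  have y: "\<beta> = of_real (a - x)"
    using vieta(1) x by (simp add: algebra_simps)
  define y where "y = a - x"
  have a: "a = x + y" and \<beta>: "\<beta> = of_real y"
    using y by (simp_all add: y_def)
  have b: "b = x * y"
    using vieta(2) unfolding x \<beta> by (metis of_real_eq_iff of_real_mult)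
  have "\<bar>x\<bar> \<ge> \<bar>y\<bar>"
    using roots by (simp add: labelled_roots_def x \<beta>)
  moreover have "a - 1 - b = (x - 1) * (1 - y)" "b + a + 1 = (x + 1) * (1 + y)"
    by (simp_all add: a b algebra_simps)
  ultimately show ?thesis
    using region_iff_products_nonneg[of x y] \<open>a \<ge> 1\<close> by (auto simp: x \<beta> a)
next
  case False
  then show ?thesis
    using roots_real labelled_roots_vieta[OF roots] by blast
qed

theorem proposition4p1:
  "D1 \<inter> D2 \<inter> D3 = {(\<alpha>, \<beta>). \<alpha> + \<beta> \<ge> 1 \<and> \<alpha> \<ge> 1 \<and> \<bar>\<beta>\<bar> \<le> 1} \<and>
   (\<forall>\<alpha> \<beta>. root_labelling \<alpha> \<beta> \<longrightarrow>
      D1' \<alpha> \<beta> \<inter> D2' \<alpha> \<beta> \<inter> D3' \<alpha> \<beta> = {(a, b). a \<ge> 1 \<and> a - 1 \<ge> b \<and> b \<ge> - a - 1})"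
proof (intro conjI allI impI)
  show "D1 \<inter> D2 \<inter> D3 = {(\<alpha>, \<beta>). \<alpha> + \<beta> \<ge> 1 \<and> \<alpha> \<ge> 1 \<and> \<bar>\<beta>\<bar> \<le> 1}"
    by (auto simp: D1_def D2_def D3_def)
next
  fix \<alpha> \<beta>
  assume "root_labelling \<alpha> \<beta>"
  then have roots: "labelled_roots a b (\<alpha> a b) (\<beta> a b)" for a b
    by (simp add: root_labelling_def)
  then have le: "cmod (\<beta> a b) \<le> cmod (\<alpha> a b)" for a b
    by (simp add: labelled_roots_def)
  have "(a, b) \<in> D1' \<alpha> \<beta> \<inter> D2' \<alpha> \<beta> \<inter> D3' \<alpha> \<beta> \<longleftrightarrow> a \<ge> 1 \<and> a - 1 \<ge> b \<and> b \<ge> - a - 1" for a b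
  proof -
    have "(a, b) \<in> D1' \<alpha> \<beta> \<inter> D2' \<alpha> \<beta> \<inter> D3' \<alpha> \<beta> \<longleftrightarrow>
        a \<ge> 1 \<and> \<alpha> a b \<in> \<real> \<and> Re (\<alpha> a b) \<ge> 1 \<and> cmod (\<beta> a b) \<le> 1"
      using le[where a = a and b = b] by (auto simp: D1'_def D2'_def D3'_def)
    then show ?thesis
      using labelled_roots_region_iff[OF roots] by blast
  qed
  then show "D1' \<alpha> \<beta> \<inter> D2' \<alpha> \<beta> \<inter> D3' \<alpha> \<beta> = {(a, b). a \<ge> 1 \<and> a - 1 \<ge> b \<and> b \<ge> - a - 1}"
    by auto
qed

end
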